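(* Let $B\in\mathcal{H}_n^{\mathrm{nd}}(\mathfrak{o})$ be optimal with $\mathrm{GK}(B)=\underline a$, and let $U\in\mathrm{GL}_n(\mathfrak{o})$. Then $B[U]$ is optimal if and only if $U\in G_{\underline a}$.
   Context: $F$ is a non-archimedean local field of characteristic $0$ with ring of integers $\mathfrak{o}$ and normalized valuation $\mathrm{ord}$ ($\mathrm{ord}(0)=+\infty$). A symmetric $B=(b_{ij})\in M_n(F)$ is half-integral if $b_{ii}\in\mathfrak{o}$ and $2b_{ij}\in\mathfrak{o}$; $\mathcal{H}_n^{\mathrm{nd}}(\mathfrak{o})$ denotes the half-integral ones with $\det B\ne0$. $B[X]={}^tXBX$. For $\underline a\in\mathbb{Z}_{\ge0}^n$, $\mathcal{M}(\underline a)$ is the set of half-integral $B$ with $\mathrm{ord}(b_{ii})\ge a_i$ and $\mathrm{ord}(2b_{ij})\ge(a_i+a_j)/2$ ($i<j$). $S(B)$ is the set of non-decreasing $\underline a\in\mathbb{Z}_{\ge0}^n$ with $B\in\mathcal{M}(\underline a)$; $\mathrm{GK}(B)$ is the lexicographically greatest element of $\bigcup_{U\in\mathrm{GL}_n(\mathfrak{o})}S(B[U])$; $B$ is optimal if $\mathrm{GK}(B)\in S(B)$. For non-decreasing $\underline a=(a_1,\dots,a_n)$, $G_{\underline a}=\{g=(g_{ij})\in\mathrm{GL}_n(\mathfrak{o}) : \mathrm{ord}(g_{ij})\ge (a_j-a_i)/2 \text{ whenever } a_i<a_j\}$. *)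

theory Defs
  imports "Jordan_Normal_Form.Determinant" "HOL-Library.Extended_Real"
begin

definition int_ring :: "('a::field_char_0 \<Rightarrow> ereal) \<Rightarrow> 'a set" where
  "int_ring ord = {x. 0 \<le> ord x}"

(* A field complete with respect to a normalized discrete valuation and with finite residue field.
   The valuation takes values in the extended reals so that its values can be compared directly
   with the half-integers (a_i + a_j)/2. Characteristic 0 is the class constraint; the residue
   characteristic is unrestricted, so 2 need not be a unit. *)
locale nonarch_local_field =
  fixes ord :: "'a::field_char_0 \<Rightarrow> ereal"
  assumes ord_zero: "ord 0 = \<infinity>"
    and ord_int: "x \<noteq> 0 \<Longrightarrow> \<exists>k::int. ord x = ereal (real_of_int k)"
    and ord_mult: "ord (x * y) = ord x + ord y"
    and ord_add: "min (ord x) (ord y) \<le> ord (x + y)"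
    and ord_normalized: "\<exists>p. ord p = 1"
    and ord_complete:
      "\<And>X :: nat \<Rightarrow> 'a.
        (\<forall>N::nat. \<exists>K. \<forall>m\<ge>K. \<forall>k\<ge>K. ereal (real N) \<le> ord (X m - X k))
        \<Longrightarrow> \<exists>l. \<forall>N::nat. \<exists>K. \<forall>m\<ge>K. ereal (real N) \<le> ord (X m - l)"
    and finite_residue_field:
      "finite (int_ring ord // {(x, y). x \<in> int_ring ord \<and> y \<in> int_ring ord \<and> 0 < ord (x - y)})"

definition int_mats :: "('a::field_char_0 \<Rightarrow> ereal) \<Rightarrow> nat \<Rightarrow> 'a mat set" where
  "int_mats ord n = {A \<in> carrier_mat n n. \<forall>i<n. \<forall>j<n. A $$ (i, j) \<in> int_ring ord}"

definition GL_int :: "('a::field_char_0 \<Rightarrow> ereal) \<Rightarrow> nat \<Rightarrow> 'a mat set" where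
  "GL_int ord n =
    {U \<in> int_mats ord n. \<exists>V \<in> int_mats ord n. inverts_mat U V \<and> inverts_mat V U}"

definition half_integral :: "('a::field_char_0 \<Rightarrow> ereal) \<Rightarrow> nat \<Rightarrow> 'a mat set" where
  "half_integral ord n =
    {B \<in> carrier_mat n n. transpose_mat B = B
      \<and> (\<forall>i<n. B $$ (i, i) \<in> int_ring ord)
      \<and> (\<forall>i<n. \<forall>j<n. 2 * B $$ (i, j) \<in> int_ring ord)}"

definition half_integral_nd :: "('a::field_char_0 \<Rightarrow> ereal) \<Rightarrow> nat \<Rightarrow> 'a mat set" where
  "half_integral_nd ord n = {B \<in> half_integral ord n. det B \<noteq> 0}"

definition mat_act :: "'a::field_char_0 mat \<Rightarrow> 'a mat \<Rightarrow> 'a mat" where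
  "mat_act B X = transpose_mat X * B * X"

(* Elements of Z_{>=0}^n are lists of naturals of length n; all indices start at 0. *)
definition M_set :: "('a::field_char_0 \<Rightarrow> ereal) \<Rightarrow> nat \<Rightarrow> nat list \<Rightarrow> 'a mat set" where
  "M_set ord n a =
    {B \<in> half_integral ord n.
      (\<forall>i<n. ereal (real (a ! i)) \<le> ord (B $$ (i, i)))
      \<and> (\<forall>i j. i < j \<and> j < n \<longrightarrow>
            ereal ((real (a ! i) + real (a ! j)) / 2) \<le> ord (2 * B $$ (i, j)))}"

definition S_set :: "('a::field_char_0 \<Rightarrow> ereal) \<Rightarrow> nat \<Rightarrow> 'a mat \<Rightarrow> nat list set" where
  "S_set ord n B = {a. length a = n \<and> sorted a \<and> B \<in> M_set ord n a}"

(* lex less_than is the strict lexicographic order on lists of equal length. *)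
definition lex_greatest :: "nat list set \<Rightarrow> nat list" where
  "lex_greatest A = (THE a. a \<in> A \<and> (\<forall>b\<in>A. b = a \<or> (b, a) \<in> lex less_than))"

(* For det B = 0 a lexicographic maximum need not exist, and then GK is unspecified. *)
definition GK :: "('a::field_char_0 \<Rightarrow> ereal) \<Rightarrow> nat \<Rightarrow> 'a mat \<Rightarrow> nat list" where
  "GK ord n B = lex_greatest (\<Union>U \<in> GL_int ord n. S_set ord n (mat_act B U))"

definition optimal :: "('a::field_char_0 \<Rightarrow> ereal) \<Rightarrow> nat \<Rightarrow> 'a mat \<Rightarrow> bool" where
  "optimal ord n B \<longleftrightarrow> GK ord n B \<in> S_set ord n B"

definition G_group :: "('a::field_char_0 \<Rightarrow> ereal) \<Rightarrow> nat \<Rightarrow> nat list \<Rightarrow> 'a mat set" where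
  "G_group ord n a =
    {g \<in> GL_int ord n. \<forall>i<n. \<forall>j<n. a ! i < a ! j \<longrightarrow>
      ereal ((real (a ! j) - real (a ! i)) / 2) \<le> ord (g $$ (i, j))}"

end

theory Submission
  imports Defs
begin

text \<open>
  Write \<open>Q(x) = B[x]\<close>, let \<open>(x, y)\<close> be the associated bilinear form, so that \<open>(x, x) = 2 Q(x)\<close>,
  and let \<open>L\<^sub>t\<close> be the lattice of integral vectors \<open>x\<close> with \<open>ord x\<^sub>i \<ge> (t - a\<^sub>i) / 2\<close> for all \<open>i\<close>.
  If \<open>B\<close> lies in \<open>M(a)\<close>, then \<open>ord Q(x) \<ge> t\<close> on \<open>L\<^sub>t\<close> and \<open>ord (x, y) \<ge> (s + t) / 2\<close> on
  \<open>L\<^sub>s \<times> L\<^sub>t\<close>, and \<open>U\<close> belongs to \<open>G\<^sub>a\<close> iff its \<open>j\<close>-th column lies in \<open>L\<^sub>t\<close> for \<open>t = a\<^sub>j\<close>;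
  this gives one direction. For the other, maximality of \<open>a\<close> forces
  \<open>L\<^bsub>t+1\<^esub> = {x \<in> L\<^sub>t. ord Q(x) \<ge> t + 1 and ord (x, y) \<ge> t + 1 for all y \<in> L\<^sub>t}\<close>.
  Hence the filtration is determined by the form and the lattice \<open>L\<^sub>0\<close> alone, and \<open>U\<close>, which
  carries the form \<open>B[U]\<close> to \<open>B\<close>, maps every \<open>L\<^sub>t\<close> onto itself. If the displayed equality failed, a
  vector of the right-hand side outside \<open>L\<^bsub>t+1\<^esub>\<close> could be truncated and rescaled to replace a basis
  vector with exponent \<open>m\<close>, raising that exponent to \<open>m + 1\<close>; the exponents after it may drop as low
  as \<open>m + 1\<close>, but the sequence still increases lexicographically.
\<close>

section \<open>Valuation bounds\<close>

context nonarch_local_field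
begin

text \<open>All bounds below are finite, often half-integers. Fixing a real bound keeps
  extended-real arithmetic out of the later arguments.\<close>

definition val_ge :: "real \<Rightarrow> 'a \<Rightarrow> bool" where
  "val_ge r x \<longleftrightarrow> ereal r \<le> ord x"

lemma ord_nonzero:
  "x \<noteq> 0 \<Longrightarrow> \<exists>k::int. ord x = ereal (real_of_int k) \<and> (\<forall>r. val_ge r x \<longleftrightarrow> r \<le> real_of_int k)"
  using ord_int[of x] by (auto simp: val_ge_def)

lemma val_ge_0 [simp]: "val_ge r 0"
  by (simp add: val_ge_def ord_zero)

lemma val_ge_mono: "val_ge r x \<Longrightarrow> s \<le> r \<Longrightarrow> val_ge s x"
  unfolding val_ge_def using ereal_less_eq(3) order_trans by blast

lemma val_ge_add: "val_ge r x \<Longrightarrow> val_ge r y \<Longrightarrow> val_ge r (x + y)"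
  unfolding val_ge_def using ord_add[of x y] by (meson min.boundedI order_trans)

lemma val_ge_mult: "val_ge r x \<Longrightarrow> val_ge s y \<Longrightarrow> val_ge (r + s) (x * y)"
  unfolding val_ge_def using ord_mult[of x y] add_mono[of "ereal r" "ord x" "ereal s" "ord y"] by simp

lemma ord_one: "ord 1 = 0"
  using ord_int[of 1] ord_mult[of 1 1] by auto

lemma ord_minus_one: "ord (-1) = 0"
  using ord_int[of "-1"] ord_mult[of "-1" "-1"] ord_one by (auto simp: zero_ereal_def)

lemma val_ge_one: "r \<le> 0 \<Longrightarrow> val_ge r 1"
  by (simp add: val_ge_def ord_one)

lemma val_ge_minus: "val_ge r x \<Longrightarrow> val_ge r (- x)"
  using ord_mult[of "-1" x] by (simp add: ord_minus_one val_ge_def)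

lemma val_ge_diff: "val_ge r x \<Longrightarrow> val_ge r y \<Longrightarrow> val_ge r (x - y)"
  using val_ge_add[of r x "- y"] val_ge_minus by simp

lemma val_ge_sum: "(\<And>i. i \<in> I \<Longrightarrow> val_ge r (f i)) \<Longrightarrow> val_ge r (sum f I)"
  by (induction I rule: infinite_finite_induct) (auto intro: val_ge_add)

lemma val_ge_prod: "(\<And>i. i \<in> I \<Longrightarrow> val_ge (r i) (f i)) \<Longrightarrow> val_ge (sum r I) (prod f I)"
proof (induction I rule: infinite_finite_induct)
  case (insert i I)
  then show ?case using val_ge_mult[of "r i" "f i" "sum r I" "prod f I"] by simp
qed (simp_all add: val_ge_one)

text \<open>Nonzero elements have integer valuation, so a half-integral bound can be rounded up. The
  later gains of half a unit come from this.\<close>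

lemma val_ge_integral: "val_ge r x \<Longrightarrow> real_of_int k < r + 1 \<Longrightarrow> val_ge (real_of_int k) x"
proof (cases "x = 0")
  case False
  assume ge: "val_ge r x" and k: "real_of_int k < r + 1"
  obtain l where l: "\<And>r. val_ge r x \<longleftrightarrow> r \<le> real_of_int l"
    using ord_nonzero[OF False] by blast
  then have "real_of_int k < real_of_int (l + 1)" using ge k by force
  then have "k \<le> l" unfolding of_int_less_iff by simp
  then show ?thesis by (simp add: l)
qed simp

lemma int_ring_iff: "x \<in> int_ring ord \<longleftrightarrow> val_ge 0 x"
  by (simp add: int_ring_def val_ge_def zero_ereal_def)

lemma val_ge_divide:
  assumes "ord u = ereal s" "val_ge r x"
  shows "val_ge (r - s) (x / u)"
proof -
  have "u \<noteq> 0" using assms(1) ord_zero by auto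
  then have "ord x = ord u + ord (x / u)" using ord_mult[of u "x / u"] by simp
  then show ?thesis using assms by (cases "ord (x / u)") (auto simp: val_ge_def)
qed

lemma exists_ord_eq: "\<exists>x. ord x = ereal (real k)"
proof -
  obtain p where p: "ord p = 1" using ord_normalized by blast
  have "ord (p ^ k) = ereal (real k)"
    by (induction k) (simp_all add: ord_one ord_mult p one_ereal_def zero_ereal_def add.commute)
  then show ?thesis by blast
qed

text \<open>Each term of the Leibniz expansion obeys the bound: a permutation only rearranges the
  weights, so the averages \<open>(w i + w (p i)) / 2\<close> add up to the sum of all
  \<open>w i\<close>.\<close>

lemma val_ge_det:
  assumes A: "A \<in> carrier_mat n n"
    and ge: "\<And>i j. i < n \<Longrightarrow> j < n \<Longrightarrow> val_ge ((w i + w j) / 2) (A $$ (i, j))"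
  shows "val_ge (\<Sum>i<n. w i) (det A)"
  unfolding det_def'[OF A]
proof (rule val_ge_sum)
  fix p assume "p \<in> {p. p permutes {0..<n}}"
  then have p: "p permutes {0..<n}" by simp
  have "(\<Sum>i=0..<n. w (p i)) = (\<Sum>i=0..<n. w i)"
    using sum.permute[OF p, of w] by (simp add: o_def)
  then have "(\<Sum>i=0..<n. (w i + w (p i)) / 2) = (\<Sum>i<n. w i)"
    by (simp add: sum.distrib atLeast0LessThan flip: sum_divide_distrib)
  moreover have "val_ge (\<Sum>i=0..<n. (w i + w (p i)) / 2) (\<Prod>i=0..<n. A $$ (i, p i))"
    using permutes_in_image[OF p] by (intro val_ge_prod ge) auto
  ultimately have *: "val_ge (\<Sum>i<n. w i) (\<Prod>i=0..<n. A $$ (i, p i))" by simp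
  show "val_ge (\<Sum>i<n. w i) (signof p * (\<Prod>i=0..<n. A $$ (i, p i)))"
    using val_ge_minus[OF *] * by (simp add: sign_def)
qed


section \<open>Integral matrices\<close>

lemma int_matsD:
  "A \<in> int_mats ord n \<Longrightarrow> A \<in> carrier_mat n n"
  "A \<in> int_mats ord n \<Longrightarrow> i < n \<Longrightarrow> j < n \<Longrightarrow> val_ge 0 (A $$ (i, j))"
  by (auto simp: int_mats_def int_ring_iff)

lemma int_matsI:
  "A \<in> carrier_mat n n \<Longrightarrow> (\<And>i j. i < n \<Longrightarrow> j < n \<Longrightarrow> val_ge 0 (A $$ (i, j))) \<Longrightarrow> A \<in> int_mats ord n"
  by (auto simp: int_mats_def int_ring_iff)

lemma int_mats_mult_vec:
  assumes "A \<in> int_mats ord n" "x \<in> carrier_vec n" "\<And>i. i < n \<Longrightarrow> val_ge 0 (x $ i)" "i < n"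
  shows "val_ge 0 ((A *\<^sub>v x) $ i)"
proof -
  have "(A *\<^sub>v x) $ i = (\<Sum>j=0..<n. A $$ (i, j) * x $ j)"
    using assms int_matsD(1)[OF assms(1)] by (auto simp: scalar_prod_def)
  also have "val_ge 0 \<dots>"
    using assms int_matsD(2)[OF assms(1)] val_ge_mult[of 0 _ 0] by (intro val_ge_sum) auto
  finally show ?thesis .
qed

lemma int_mats_mult:
  assumes "A \<in> int_mats ord n" "B \<in> int_mats ord n"
  shows "A * B \<in> int_mats ord n"
proof (rule int_matsI)
  show "A * B \<in> carrier_mat n n" using assms[THEN int_matsD(1)] by auto
  fix i j assume "i < n" "j < n"
  then show "val_ge 0 ((A * B) $$ (i, j))"
    using int_mats_mult_vec[OF assms(1), of "col B j" i] assms[THEN int_matsD(1)]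
      int_matsD(2)[OF assms(2)] by (auto simp: scalar_prod_def)
qed

lemma GL_intE:
  assumes "U \<in> GL_int ord n"
  obtains V where "U \<in> int_mats ord n" "V \<in> int_mats ord n" "U * V = 1\<^sub>m n" "V * U = 1\<^sub>m n"
    "V \<in> GL_int ord n" "U \<in> carrier_mat n n" "V \<in> carrier_mat n n"
proof -
  obtain V where V: "V \<in> int_mats ord n" "inverts_mat U V" "inverts_mat V U" and U: "U \<in> int_mats ord n"
    using assms by (auto simp: GL_int_def)
  have "V \<in> GL_int ord n" using U V by (auto simp: GL_int_def)
  then show ?thesis using that U V int_matsD(1)[OF U] int_matsD(1)[OF V(1)]
    by (auto simp: inverts_mat_def)
qed

lemma GL_intI:
  assumes "U \<in> int_mats ord n" "V \<in> int_mats ord n" "U * V = 1\<^sub>m n" "V * U = 1\<^sub>m n"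
  shows "U \<in> GL_int ord n"
  using assms assms(1,2)[THEN int_matsD(1)] by (auto simp: GL_int_def inverts_mat_def)

lemma GL_int_carrier: "U \<in> GL_int ord n \<Longrightarrow> U \<in> carrier_mat n n"
  by (auto simp: GL_int_def int_mats_def)

lemma GL_int_mult:
  assumes "U \<in> GL_int ord n" "V \<in> GL_int ord n"
  shows "U * V \<in> GL_int ord n"
proof -
  obtain U' where U: "U \<in> int_mats ord n" "U' \<in> int_mats ord n" "U * U' = 1\<^sub>m n" "U' * U = 1\<^sub>m n"
    "U \<in> carrier_mat n n" "U' \<in> carrier_mat n n" using GL_intE[OF assms(1)] by blast
  obtain V' where V: "V \<in> int_mats ord n" "V' \<in> int_mats ord n" "V * V' = 1\<^sub>m n" "V' * V = 1\<^sub>m n"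
    "V \<in> carrier_mat n n" "V' \<in> carrier_mat n n" using GL_intE[OF assms(2)] by blast
  have "(U * V) * (V' * U') = U * ((V * V') * U')"
    using U(5,6) V(5,6) by (simp add: assoc_mult_mat[of _ n n _ n _ n])
  moreover have "(V' * U') * (U * V) = V' * ((U' * U) * V)"
    using U(5,6) V(5,6) by (simp add: assoc_mult_mat[of _ n n _ n _ n])
  ultimately show ?thesis
    using U V by (intro GL_intI[of _ _ "V' * U'"] int_mats_mult) auto
qed

lemma mat_act_carrier: "B \<in> carrier_mat n n \<Longrightarrow> U \<in> carrier_mat n n \<Longrightarrow> mat_act B U \<in> carrier_mat n n"
  by (auto simp: mat_act_def)

lemma mat_act_mult:
  assumes "B \<in> carrier_mat n n" "U \<in> carrier_mat n n" "V \<in> carrier_mat n n"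
  shows "mat_act (mat_act B U) V = mat_act B (U * V)"
  using assms by (simp add: mat_act_def transpose_mult[of _ n n] assoc_mult_mat[of _ n n _ n _ n])

lemma mat_act_symmetric:
  assumes "B \<in> carrier_mat n n" "U \<in> carrier_mat n n" "transpose_mat B = B"
  shows "transpose_mat (mat_act B U) = mat_act B U"
  unfolding mat_act_def using assms
  by (subst transpose_mult[of _ n n _ n], simp, simp, subst transpose_mult[of _ n n _ n])
    (simp_all add: assoc_mult_mat[of _ n n _ n _ n])

text \<open>Left multiplication by \<open>U\<close> permutes \<open>GL_int ord n\<close>. Hence
  \<open>B\<close> and \<open>B[U]\<close> have the same Gross-Keating invariant.\<close>

lemma GL_int_orbit:
  assumes B: "B \<in> carrier_mat n n" and U: "U \<in> GL_int ord n"
  shows "(\<Union>V \<in> GL_int ord n. S_set ord n (mat_act (mat_act B U) V)) =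
    (\<Union>V \<in> GL_int ord n. S_set ord n (mat_act B V))"
proof -
  obtain U' where U': "U * U' = 1\<^sub>m n" "U' \<in> GL_int ord n" "U \<in> carrier_mat n n" "U' \<in> carrier_mat n n"
    using GL_intE[OF U] by blast
  have "(\<lambda>V. U * V) ` GL_int ord n = GL_int ord n"
  proof (intro equalityI subsetI)
    fix V assume V: "V \<in> GL_int ord n"
    have "V = (U * U') * V" using GL_int_carrier[OF V] U' by simp
    also have "\<dots> = U * (U' * V)"
      using GL_int_carrier[OF V] U'(3,4) by (simp add: assoc_mult_mat[of _ n n _ n _ n])
    finally show "V \<in> (\<lambda>V. U * V) ` GL_int ord n" using GL_int_mult[OF U'(2) V] by blast
  next
    fix W assume "W \<in> (\<lambda>V. U * V) ` GL_int ord n"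
    then show "W \<in> GL_int ord n" using GL_int_mult[OF U] by blast
  qed
  then have "(\<Union>V \<in> GL_int ord n. S_set ord n (mat_act B V)) =
      (\<Union>V \<in> GL_int ord n. S_set ord n (mat_act B (U * V)))"
    by (metis image_image)
  then show ?thesis using B U'(3) by (simp add: mat_act_mult[OF _ _ GL_int_carrier])
qed


section \<open>The bilinear form and the filtration of an exponent sequence\<close>

text \<open>No factor 2 is built in: the quadratic form Q(x) is \<open>bil B x x\<close> and the
  pairing (x, y) is \<open>2 * bil B x y\<close>. As 2 may be a non-unit, bounds on the two are kept
  apart.\<close>

definition bil :: "'a mat \<Rightarrow> 'a vec \<Rightarrow> 'a vec \<Rightarrow> 'a" where
  "bil B x y = x \<bullet> (B *\<^sub>v y)"

lemma bil_sum:
  assumes "B \<in> carrier_mat n n" "x \<in> carrier_vec n" "y \<in> carrier_vec n"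
  shows "bil B x y = (\<Sum>i<n. \<Sum>j<n. x $ i * B $$ (i, j) * y $ j)"
  using assms
  by (auto simp: bil_def scalar_prod_def atLeast0LessThan sum_distrib_left mult.assoc intro!: sum.cong)

lemma bil_commute:
  assumes "B \<in> carrier_mat n n" "x \<in> carrier_vec n" "y \<in> carrier_vec n" "transpose_mat B = B"
  shows "bil B x y = bil B y x"
proof -
  have "B $$ (i, j) = B $$ (j, i)" if "i < n" "j < n" for i j
    using that assms(1,4) by (metis carrier_matD index_transpose_mat(1))
  then show ?thesis
    unfolding bil_sum[OF assms(1,2,3)] bil_sum[OF assms(1,3,2)]
    by (subst sum.swap) (auto intro!: sum.cong)
qed

lemma bil_diff_left:
  assumes "B \<in> carrier_mat n n" "x \<in> carrier_vec n" "y \<in> carrier_vec n" "z \<in> carrier_vec n"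
  shows "bil B (x - y) z = bil B x z - bil B y z"
  using assms by (auto simp: bil_def intro!: minus_scalar_prod_distrib)

lemma bil_smult_left:
  assumes "B \<in> carrier_mat n n" "x \<in> carrier_vec n" "z \<in> carrier_vec n"
  shows "bil B (c \<cdot>\<^sub>v x) z = c * bil B x z"
  using assms by (auto simp: bil_def intro!: smult_scalar_prod_distrib)

lemma bil_mat_act:
  assumes "B \<in> carrier_mat n n" "U \<in> carrier_mat n n" "x \<in> carrier_vec n" "y \<in> carrier_vec n"
  shows "bil (mat_act B U) x y = bil B (U *\<^sub>v x) (U *\<^sub>v y)"
proof -
  let ?By = "B *\<^sub>v (U *\<^sub>v y)"
  have "mat_act B U *\<^sub>v y = transpose_mat U *\<^sub>v ?By"
    using assms by (simp add: mat_act_def assoc_mult_mat_vec[of _ n n _ n])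
  moreover have "x \<bullet> (transpose_mat U *\<^sub>v ?By) = (transpose_mat U *\<^sub>v ?By) \<bullet> x"
    using assms by (intro comm_scalar_prod[of _ n]) auto
  moreover have "(transpose_mat U *\<^sub>v ?By) \<bullet> x = ?By \<bullet> (U *\<^sub>v x)"
    using assms by (intro transpose_vec_mult_scalar) auto
  moreover have "?By \<bullet> (U *\<^sub>v x) = (U *\<^sub>v x) \<bullet> ?By"
    using assms by (intro comm_scalar_prod[of _ n]) auto
  ultimately show ?thesis by (simp add: bil_def)
qed

lemma mult_unit_vec: "(A :: 'a mat) \<in> carrier_mat n n \<Longrightarrow> i < n \<Longrightarrow> A *\<^sub>v unit_vec n i = col A i"
  by (intro eq_vecI) auto

lemma mat_act_index:
  assumes "B \<in> carrier_mat n n" "U \<in> carrier_mat n n" "i < n" "j < n"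
  shows "mat_act B U $$ (i, j) = bil B (col U i) (col U j)"
proof -
  have "mat_act B U $$ (i, j) = bil (mat_act B U) (unit_vec n i) (unit_vec n j)"
    using mat_act_carrier[OF assms(1,2)] assms by (simp add: bil_def)
  also have "\<dots> = bil B (col U i) (col U j)"
    using assms by (simp add: bil_mat_act mult_unit_vec)
  finally show ?thesis .
qed

text \<open>Off-diagonal terms are paired so that they carry the factor 2, because half-integrality
  controls only 2 b_ij there.\<close>

lemma sum_symmetric_split:
  fixes f :: "nat \<Rightarrow> nat \<Rightarrow> 'b::comm_ring_1"
  assumes "\<And>i j. i < n \<Longrightarrow> j < n \<Longrightarrow> f i j = f j i"
  shows "(\<Sum>i<n. \<Sum>j<n. f i j) = (\<Sum>i<n. f i i + (\<Sum>j<i. 2 * f i j))"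
  using assms
proof (induction n)
  case (Suc n)
  have "(\<Sum>i<n. f i n) = (\<Sum>i<n. f n i)" using Suc.prems by (intro sum.cong) auto
  then show ?case using Suc.IH Suc.prems
    by (simp add: sum.distrib algebra_simps flip: sum_distrib_left)
qed simp

text \<open>This is the lattice L_t. With \<open>t\<close> real, \<open>t - real (a ! i)\<close> may
  be negative; the bound 0 then keeps the coordinate integral.\<close>

definition filt :: "nat \<Rightarrow> nat list \<Rightarrow> real \<Rightarrow> 'a vec set" where
  "filt n a t = {x \<in> carrier_vec n. \<forall>i<n. val_ge 0 (x $ i) \<and> val_ge ((t - real (a ! i)) / 2) (x $ i)}"

lemma filtD:
  assumes "x \<in> filt n a t"
  shows "x \<in> carrier_vec n" "i < n \<Longrightarrow> val_ge 0 (x $ i)" "i < n \<Longrightarrow> val_ge ((t - real (a ! i)) / 2) (x $ i)"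
  using assms by (auto simp: filt_def)

lemma filt_mono: "s \<le> t \<Longrightarrow> filt n a t \<subseteq> filt n a s"
  by (auto simp: filt_def intro: val_ge_mono[of "(t - _) / 2"])

lemma filt_diff: "x \<in> filt n a t \<Longrightarrow> y \<in> filt n a t \<Longrightarrow> x - y \<in> filt n a t"
  by (auto simp: filt_def intro!: val_ge_diff)

lemma smult_unit_vec_filt:
  assumes "i < n" "val_ge 0 c" "val_ge ((t - real (a ! i)) / 2) c"
  shows "c \<cdot>\<^sub>v unit_vec n i \<in> filt n a t"
proof -
  have "val_ge 0 ((c \<cdot>\<^sub>v unit_vec n i) $ j) \<and> val_ge ((t - real (a ! j)) / 2) ((c \<cdot>\<^sub>v unit_vec n i) $ j)"
    if "j < n" for j
    using assms that by (cases "j = i") (auto simp: index_unit_vec(1))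
  then show ?thesis by (auto simp: filt_def)
qed

lemma unit_vec_filt: "i < n \<Longrightarrow> unit_vec n i \<in> filt n a (real (a ! i))"
  using smult_unit_vec_filt[of i n 1 "real (a ! i)" a] by (simp add: val_ge_one)

section \<open>Values of a form in M(a) on the lattices L_t\<close>

lemma M_setD:
  assumes "B \<in> M_set ord n a"
  shows "B \<in> carrier_mat n n" "transpose_mat B = B"
    and "i < n \<Longrightarrow> val_ge (real (a ! i)) (B $$ (i, i))"
    and "i < n \<Longrightarrow> j < n \<Longrightarrow> val_ge ((real (a ! i) + real (a ! j)) / 2) (2 * B $$ (i, j))"
proof -
  show B: "B \<in> carrier_mat n n" "transpose_mat B = B"
    using assms by (auto simp: M_set_def half_integral_def)
  show diag: "val_ge (real (a ! i)) (B $$ (i, i))" if "i < n" for i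
    using assms that by (auto simp: M_set_def val_ge_def)
  assume ij: "i < n" "j < n"
  have sym: "B $$ (i, j) = B $$ (j, i)" using B ij by (metis carrier_matD index_transpose_mat(1))
  consider "i < j" | "j < i" | "i = j" by linarith
  then show "val_ge ((real (a ! i) + real (a ! j)) / 2) (2 * B $$ (i, j))"
  proof cases
    case 1
    then show ?thesis using assms ij unfolding M_set_def val_ge_def by blast
  next
    case 2
    then have "val_ge ((real (a ! j) + real (a ! i)) / 2) (2 * B $$ (j, i))"
      using assms ij unfolding M_set_def val_ge_def by blast
    then show ?thesis by (simp add: sym add.commute)
  next
    case 3
    then show ?thesis using val_ge_add[OF diag[OF ij(1)] diag[OF ij(1)]] by (simp only: mult_2) simp
  qed
qed

lemma M_setI:
  assumes "B \<in> carrier_mat n n" "transpose_mat B = B"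
    and diag: "\<And>i. i < n \<Longrightarrow> val_ge (real (a ! i)) (B $$ (i, i))"
    and off: "\<And>i j. i < j \<Longrightarrow> j < n \<Longrightarrow> val_ge ((real (a ! i) + real (a ! j)) / 2) (2 * B $$ (i, j))"
  shows "B \<in> M_set ord n a"
proof -
  have sym: "B $$ (i, j) = B $$ (j, i)" if "i < n" "j < n" for i j
    using assms(1,2) that by (metis carrier_matD index_transpose_mat(1))
  have diag0: "val_ge 0 (B $$ (i, i))" if "i < n" for i
    using diag[OF that] by (rule val_ge_mono) simp
  have off0: "val_ge 0 (2 * B $$ (i, j))" if "i < j" "j < n" for i j
    using off[OF that] by (rule val_ge_mono) simp
  have all0: "val_ge 0 (2 * B $$ (i, j))" if "i < n" "j < n" for i j
  proof -
    consider "i < j" | "j < i" | "i = j" by linarith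
    then show ?thesis
    proof cases
      case 1
      then show ?thesis using off0 that by blast
    next
      case 2
      then show ?thesis using off0[of j i] that sym[OF that] by simp
    next
      case 3
      then show ?thesis using val_ge_add[OF diag0[OF that(1)] diag0[OF that(1)]] by (simp only: mult_2)
    qed
  qed
  have "B \<in> half_integral ord n"
    using assms(1,2) diag0 all0 unfolding half_integral_def int_ring_iff by blast
  then show ?thesis
    using diag off unfolding M_set_def val_ge_def by blast
qed

text \<open>The weights cancel in every term: (s - a_i)/2 + (a_i + a_j)/2 + (t - a_j)/2 = (s +
  t)/2.\<close>

lemma val_ge_bil:
  assumes B: "B \<in> M_set ord n a" and x: "x \<in> filt n a s" and y: "y \<in> filt n a t"
  shows "val_ge ((s + t) / 2) (2 * bil B x y)"
proof -
  have "2 * bil B x y = (\<Sum>i<n. \<Sum>j<n. x $ i * (2 * B $$ (i, j)) * y $ j)"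
    unfolding bil_sum[OF M_setD(1)[OF B] filtD(1)[OF x] filtD(1)[OF y]]
    by (simp add: sum_distrib_left algebra_simps)
  also have "val_ge ((s + t) / 2) \<dots>"
  proof (intro val_ge_sum)
    fix i j assume "i \<in> {..<n}" "j \<in> {..<n}"
    then have ij: "i < n" "j < n" by auto
    have e: "(s + t) / 2 = (s - real (a ! i)) / 2 + (real (a ! i) + real (a ! j)) / 2 + (t - real (a ! j)) / 2"
      by (simp add: field_simps)
    show "val_ge ((s + t) / 2) (x $ i * (2 * B $$ (i, j)) * y $ j)"
      unfolding e by (intro val_ge_mult filtD(3)[OF x] filtD(3)[OF y] M_setD(4)[OF B] ij)
  qed
  finally show ?thesis .
qed

text \<open>\<open>val_ge_bil\<close> would bound only 2 Q(x), which is weaker when 2 is a non-unit.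
  The expansion into b_ii x_i^2 and 2 b_ij x_i x_j gives the bound for Q(x) itself.\<close>

lemma val_ge_quad:
  assumes B: "B \<in> M_set ord n a" and x: "x \<in> filt n a t"
  shows "val_ge t (bil B x x)"
proof -
  define f where "f i j = x $ i * B $$ (i, j) * x $ j" for i j
  have sym: "B $$ (i, j) = B $$ (j, i)" if "i < n" "j < n" for i j
    using M_setD(1,2)[OF B] that by (metis carrier_matD index_transpose_mat(1))
  have "bil B x x = (\<Sum>i<n. \<Sum>j<n. f i j)"
    unfolding f_def by (rule bil_sum[OF M_setD(1)[OF B] filtD(1)[OF x] filtD(1)[OF x]])
  also have "\<dots> = (\<Sum>i<n. f i i + (\<Sum>j<i. 2 * f i j))"
    by (rule sum_symmetric_split) (use sym in \<open>simp add: f_def algebra_simps\<close>)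
  also have "val_ge t \<dots>"
  proof (intro val_ge_sum val_ge_add)
    fix i assume "i \<in> {..<n}"
    then have i: "i < n" by auto
    have e: "t = (t - real (a ! i)) / 2 + real (a ! i) + (t - real (a ! i)) / 2"
      by (simp add: field_simps)
    show "val_ge t (f i i)"
      unfolding f_def
      by (subst e) (intro val_ge_mult filtD(3)[OF x] M_setD(3)[OF B] i)
    fix j assume "j \<in> {..<i}"
    then have j: "j < n" using i by simp
    have e: "t = (t - real (a ! i)) / 2 + (real (a ! i) + real (a ! j)) / 2 + (t - real (a ! j)) / 2"
      by (simp add: field_simps)
    have "val_ge t (x $ i * (2 * B $$ (i, j)) * x $ j)"
      by (subst e) (intro val_ge_mult filtD(3)[OF x] M_setD(4)[OF B] i j)
    then show "val_ge t (2 * f i j)" by (simp add: f_def mult.assoc mult.left_commute)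
  qed
  finally show ?thesis .
qed

text \<open>For a_i >= a_j the column condition is a bound by a number <= 0, which integrality of
  \<open>U\<close> supplies.\<close>

lemma G_group_iff_filt:
  assumes "U \<in> GL_int ord n"
  shows "U \<in> G_group ord n a \<longleftrightarrow> (\<forall>j<n. col U j \<in> filt n a (real (a ! j)))"
proof -
  obtain U1: "U \<in> int_mats ord n" and U: "U \<in> carrier_mat n n"
    using GL_intE[OF assms] by blast
  have *: "(a ! i < a ! j \<longrightarrow> val_ge ((real (a ! j) - real (a ! i)) / 2) (U $$ (i, j))) \<longleftrightarrow>
      val_ge ((real (a ! j) - real (a ! i)) / 2) (U $$ (i, j))" if "i < n" "j < n" for i j
    using val_ge_mono[OF int_matsD(2)[OF U1 that]] by (cases "a ! i < a ! j") auto
  have "U \<in> G_group ord n a \<longleftrightarrow>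
      (\<forall>i<n. \<forall>j<n. val_ge ((real (a ! j) - real (a ! i)) / 2) (U $$ (i, j)))"
    using * assms by (auto simp: G_group_def simp flip: val_ge_def)
  also have "\<dots> \<longleftrightarrow> (\<forall>j<n. col U j \<in> filt n a (real (a ! j)))"
    using U int_matsD(2)[OF U1] by (auto simp: filt_def)
  finally show ?thesis .
qed

text \<open>The entries of B[U] are values of the form on pairs of columns of \<open>U\<close>. This
  is the direction from G_a to optimality.\<close>

lemma M_set_mat_act:
  assumes B: "B \<in> M_set ord n a" and U: "U \<in> carrier_mat n n"
    and col: "\<And>j. j < n \<Longrightarrow> col U j \<in> filt n a (real (a ! j))"
  shows "mat_act B U \<in> M_set ord n a"
  using M_setD(1,2)[OF B] U val_ge_quad[OF B col] val_ge_bil[OF B col col]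
  by (intro M_setI) (simp_all add: mat_act_carrier mat_act_symmetric mat_act_index)

lemma val_ge_integral_nat: "val_ge r x \<Longrightarrow> real k < r + 1 \<Longrightarrow> val_ge (real k) x"
  using val_ge_integral[of r x "int k"] by simp

text \<open>Induction on \<open>t\<close>. The start L_0 consists of all integral vectors, which
  \<open>U\<close> and its inverse preserve. Each further step is cut out by the form alone, and
  \<open>U\<close> carries the form of B[U] to that of \<open>B\<close>.\<close>

lemma filt_transport:
  assumes B: "B \<in> carrier_mat n n" and U: "U \<in> GL_int ord n"
    and stepB: "\<And>t. filt n a (real (Suc t)) = {x \<in> filt n a (real t). val_ge (real (Suc t)) (bil B x x) \<and>
      (\<forall>y\<in>filt n a (real t). val_ge (real (Suc t)) (2 * bil B x y))}"
    and stepBU: "\<And>t. filt n a (real (Suc t)) = {x \<in> filt n a (real t). val_ge (real (Suc t)) (bil (mat_act B U) x x) \<and>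
      (\<forall>y\<in>filt n a (real t). val_ge (real (Suc t)) (2 * bil (mat_act B U) x y))}"
  shows "(\<lambda>x. U *\<^sub>v x) ` filt n a (real t) = filt n a (real t)"
proof -
  obtain U' where U': "U \<in> int_mats ord n" "U' \<in> int_mats ord n" "U * U' = 1\<^sub>m n"
    "U \<in> carrier_mat n n" "U' \<in> carrier_mat n n"
    using GL_intE[OF U] by blast
  have inv: "U *\<^sub>v (U' *\<^sub>v x) = x" if "x \<in> carrier_vec n" for x
    using assoc_mult_mat_vec[OF U'(4,5) that] that U'(3) by simp
  show ?thesis
  proof (induction t)
    case 0
    have filt0: "filt n a (real 0) = {x \<in> carrier_vec n. \<forall>i<n. val_ge 0 (x $ i)}"
      by (auto simp: filt_def intro: val_ge_mono[of 0])
    show ?case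
    proof (intro equalityI subsetI)
      fix x assume "x \<in> (\<lambda>x. U *\<^sub>v x) ` filt n a (real 0)"
      then show "x \<in> filt n a (real 0)"
        using int_mats_mult_vec[OF U'(1)] U'(4) unfolding filt0 by auto
    next
      fix x assume x: "x \<in> filt n a (real 0)"
      then have "U' *\<^sub>v x \<in> filt n a (real 0)"
        using int_mats_mult_vec[OF U'(2)] U'(5) unfolding filt0 by auto
      moreover have "x = U *\<^sub>v (U' *\<^sub>v x)" using inv filtD(1)[OF x] by simp
      ultimately show "x \<in> (\<lambda>x. U *\<^sub>v x) ` filt n a (real 0)" by blast
    qed
  next
    case (Suc t)
    let ?F = "filt n a (real t)"
    have act: "bil (mat_act B U) x y = bil B (U *\<^sub>v x) (U *\<^sub>v y)" if "x \<in> ?F" "y \<in> ?F" for x y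
      using bil_mat_act[OF B U'(4) filtD(1) filtD(1)] that by blast
    have "filt n a (real (Suc t)) = {x \<in> ?F. val_ge (real (Suc t)) (bil B (U *\<^sub>v x) (U *\<^sub>v x)) \<and>
        (\<forall>y\<in>?F. val_ge (real (Suc t)) (2 * bil B (U *\<^sub>v x) (U *\<^sub>v y)))}"
      unfolding stepBU using act by auto
    also have "(\<lambda>x. U *\<^sub>v x) ` \<dots> = {x \<in> (\<lambda>x. U *\<^sub>v x) ` ?F. val_ge (real (Suc t)) (bil B x x) \<and>
        (\<forall>y\<in>(\<lambda>x. U *\<^sub>v x) ` ?F. val_ge (real (Suc t)) (2 * bil B x y))}"
      by auto
    also have "\<dots> = filt n a (real (Suc t))"
      unfolding Suc.IH by (rule stepB[symmetric])
    finally show ?case .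
  qed
qed


section \<open>Improving a sequence\<close>

text \<open>Provides the vector that replaces the \<open>i\<close>-th basis vector: its own value
  gains one unit, and its pairings with basis vectors of exponent at most a_i gain half a unit over
  the bound from M(a).\<close>

lemma obtain_reducible_vector:
  assumes B: "B \<in> M_set ord n a" and a: "length a = n" "sorted a"
    and v: "v \<in> filt n a (real t)" "v \<notin> filt n a (real (Suc t))"
    and quad: "val_ge (real (Suc t)) (bil B v v)"
    and radical: "\<And>y. y \<in> filt n a (real t) \<Longrightarrow> val_ge (real (Suc t)) (2 * bil B v y)"
  obtains i e where "i < n" "e \<in> filt n a (real (a ! i))" "e $ i = 1"
    "val_ge (real (a ! i) + 1) (bil B e e)"
    "\<And>j. j < n \<Longrightarrow> a ! j \<le> a ! i \<Longrightarrow>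
      val_ge ((real (a ! i) + real (a ! j) + 1) / 2) (2 * bil B e (unit_vec n j))"
proof -
  have cv: "v \<in> carrier_vec n" using filtD(1)[OF v(1)] .
  define K where "K = {i. i < n \<and> \<not> val_ge ((real (Suc t) - real (a ! i)) / 2) (v $ i)}"
  define i where "i = Max K"
  \<comment> \<open>Since \<open>t - a\<^sub>i\<close> is an integer, \<open>i\<close> can only violate the bound for \<open>t + 1\<close> if \<open>2 ord v\<^sub>i = t - a\<^sub>i\<close>.\<close>
  define m where "m = a ! i"
  have "finite K" by (simp add: K_def)
  moreover have "K \<noteq> {}" using v filtD(2)[OF v(1)] by (auto simp: K_def filt_def)
  ultimately have "i \<in> K" and maxi: "\<And>j. j \<in> K \<Longrightarrow> j \<le> i"
    unfolding i_def by (auto intro: Max_in)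
  then have i: "i < n" and nge: "\<not> val_ge ((real (Suc t) - real m) / 2) (v $ i)"
    by (auto simp: K_def m_def)
  have "v $ i \<noteq> 0" using nge by auto
  then obtain k where k: "ord (v $ i) = ereal (real_of_int k)"
    and ge_k: "\<And>r. val_ge r (v $ i) \<longleftrightarrow> r \<le> real_of_int k"
    using ord_nonzero by blast
  have k0: "k \<ge> 0" using filtD(2)[OF v(1) i] by (simp add: ge_k)
  have "real t - real m \<le> 2 * real_of_int k" "2 * real_of_int k < real t + 1 - real m"
    using filtD(3)[OF v(1) i] nge by (simp_all add: ge_k m_def)
  then have "int t - int m \<le> 2 * k" "2 * k < int t + 1 - int m" by linarith+
  then have tm: "int t = int m + 2 * k" by linarith
  then have rk: "real_of_int k = (real t - real m) / 2"
    by (metis (mono_tags, opaque_lifting) add_diff_cancel_left' nonzero_mult_div_cancel_left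
        of_int_diff of_int_mult of_int_numeral of_int_of_nat_eq zero_neq_numeral)
  have mt: "m \<le> t" using tm k0 by linarith

  \<comment> \<open>The entries of \<open>v\<close> in positions with \<open>a\<^sub>j > m\<close> need not be divisible by \<open>v\<^sub>i\<close>, but they
    already form a vector of the next filtration step.\<close>
  define w where "w = vec n (\<lambda>j. if a ! j \<le> m then v $ j else 0)"
  define z where "z = vec n (\<lambda>j. if a ! j \<le> m then 0 else v $ j)"
  define e where "e = (1 / v $ i) \<cdot>\<^sub>v w"
  have carr: "w \<in> carrier_vec n" "z \<in> carrier_vec n" "e \<in> carrier_vec n"
    by (auto simp: w_def z_def e_def)
  have z: "z \<in> filt n a (real (Suc t))"
  proof -
    have "val_ge ((real (Suc t) - real (a ! j)) / 2) (v $ j)" if "j < n" "\<not> a ! j \<le> m" for j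
    proof -
      \<comment> \<open>As \<open>a\<close> is sorted, a_j > m places \<open>j\<close> after
        \<open>i\<close>, the last index violating the bound.\<close>
      have "\<not> j \<le> i" using that a i sorted_nth_mono[of a j i] by (auto simp: m_def)
      then show ?thesis using maxi[of j] that(1) by (auto simp: K_def)
    qed
    then show ?thesis using filtD(2)[OF v(1)] by (auto simp: filt_def z_def)
  qed
  have zt: "z \<in> filt n a (real t)" using filt_mono[of "real t" "real (Suc t)" n a] z by auto
  have w_eq: "w = v - z" using cv by (intro eq_vecI) (auto simp: w_def z_def)
  have w: "w \<in> filt n a (real t)" unfolding w_eq by (intro filt_diff v zt)
  have Bc: "B \<in> carrier_mat n n" "transpose_mat B = B" using M_setD(1,2)[OF B] .
  have w_radical: "val_ge (real (Suc t)) (2 * bil B w y)" if y: "y \<in> filt n a (real t)" for y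
  proof -
    \<comment> \<open>The bound from L_{t+1} and L_t is t + 1/2, which rounds up to t + 1;
      subtracting \<open>z\<close> therefore costs nothing.\<close>
    have "val_ge (real (Suc t)) (2 * bil B z y)"
      by (rule val_ge_integral_nat[OF val_ge_bil[OF B z y]]) simp
    then show ?thesis
      using val_ge_diff[OF radical[OF y]] bil_diff_left[OF Bc(1) cv carr(2) filtD(1)[OF y]]
      by (simp add: w_eq right_diff_distrib)
  qed
  have w_quad: "val_ge (real (Suc t)) (bil B w w)"
  proof -
    have "bil B w w = bil B v (v - z) - bil B z (v - z)"
      unfolding w_eq using bil_diff_left[OF Bc(1) cv carr(2)] cv carr by simp
    also have "\<dots> = (bil B v v - bil B v z) - (bil B z v - bil B z z)"
      using bil_commute[OF Bc(1) _ _ Bc(2)] bil_diff_left[OF Bc(1) cv carr(2)] cv carr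
      by (metis minus_carrier_vec)
    also have "\<dots> = bil B v v - 2 * bil B v z + bil B z z"
      using bil_commute[OF Bc(1) cv carr(2) Bc(2)] by simp
    finally show ?thesis
      using val_ge_add[OF val_ge_diff[OF quad radical[OF zt]] val_ge_quad[OF B z]] by simp
  qed

  have e_index: "e $ j = w $ j / v $ i" if "j < n" for j
    using that carr by (simp add: e_def)
  have em: "e \<in> filt n a (real m)"
  proof -
    have "val_ge 0 (e $ j) \<and> val_ge ((real m - real (a ! j)) / 2) (e $ j)" if j: "j < n" for j
    proof (cases "a ! j \<le> m")
      case True
      \<comment> \<open>Dividing by v_i costs k = (t - m)/2, which takes the bounds of L_t to those
        of L_m. Integrality holds because only entries with a_j <= m survive.\<close>
      have "val_ge ((real t - real (a ! j)) / 2 - (real t - real m) / 2) (e $ j)"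
        unfolding e_index[OF j] using val_ge_divide[OF k filtD(3)[OF w j]] by (simp add: rk)
      then have "val_ge ((real m - real (a ! j)) / 2) (e $ j)"
        by (rule val_ge_mono) (simp add: field_simps)
      then show ?thesis using True by (auto intro: val_ge_mono)
    next
      case False
      then show ?thesis using j by (simp add: e_index w_def)
    qed
    then show ?thesis using carr by (auto simp: filt_def)
  qed
  have "e $ i = 1" using i \<open>v $ i \<noteq> 0\<close> by (simp add: e_index w_def m_def)
  moreover have "val_ge (real m + 1) (bil B e e)"
  proof -
    have "bil B e e = bil B w w / v $ i / v $ i"
      using bil_smult_left[OF Bc(1) carr(1) carr(3), of "1 / v $ i"]
        bil_smult_left[OF Bc(1) carr(1) carr(1), of "1 / v $ i"]
        bil_commute[OF Bc(1) carr(1) carr(3) Bc(2)]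
      by (simp flip: e_def)
    then show ?thesis
      using val_ge_divide[OF k val_ge_divide[OF k w_quad]]
      by (elim val_ge_mono[rotated] ssubst) (simp add: rk)
  qed
  moreover have "val_ge ((real m + real (a ! j) + 1) / 2) (2 * bil B e (unit_vec n j))"
    if j: "j < n" "a ! j \<le> m" for j
  proof (cases "even (m + a ! j)")
    \<comment> \<open>For odd \<open>m + a\<^sub>j\<close> the general bound is a half-integer and can be rounded up.\<close>
    case False
    then obtain c where c: "m + a ! j = 2 * c + 1" by (elim oddE)
    have "real m + real (a ! j) = real (m + a ! j)" by simp
    then have rc: "real m + real (a ! j) = 2 * real c + 1" unfolding c by simp
    have "val_ge (real (c + 1)) (2 * bil B e (unit_vec n j))"
      by (rule val_ge_integral_nat[OF val_ge_bil[OF B em unit_vec_filt[OF j(1)]]]) (simp add: rc)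
    then show ?thesis by (rule val_ge_mono) (simp add: rc)
  next
    case True
    \<comment> \<open>By \<open>tm\<close>, t and m have equal parity, so t - a_j is even. A scalar
      \<open>q\<close> of half that valuation moves the unit vector into L_t, where
      \<open>w_radical\<close> applies. Undoing both scalings leaves (m + a_j)/2 + 1, more than is
      asked.\<close>
    have "even (t - a ! j)" using True tm mt j(2) by presburger
    then obtain d where d: "t - a ! j = 2 * d" by blast
    then have "t = a ! j + 2 * d" using mt j(2) by linarith
    then have rd: "real t = real (a ! j) + 2 * real d" by simp
    obtain q where q: "ord q = ereal (real d)" using exists_ord_eq by blast
    have "q \<cdot>\<^sub>v unit_vec n j \<in> filt n a (real t)"
      using j(1) q by (intro smult_unit_vec_filt) (simp_all add: val_ge_def rd)
    then have "val_ge (real (Suc t)) (2 * bil B w (q \<cdot>\<^sub>v unit_vec n j))"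
      by (rule w_radical)
    moreover have "bil B e (unit_vec n j) = bil B w (q \<cdot>\<^sub>v unit_vec n j) / q / v $ i"
    proof -
      have "q \<noteq> 0" using q ord_zero by auto
      moreover have "bil B w (q \<cdot>\<^sub>v unit_vec n j) = q * bil B w (unit_vec n j)"
        using bil_commute[OF Bc(1) carr(1) _ Bc(2)] bil_smult_left[OF Bc(1) _ carr(1)]
        by (metis smult_carrier_vec unit_vec_carrier)
      ultimately show ?thesis
        using bil_smult_left[OF Bc(1) carr(1), of "unit_vec n j" "1 / v $ i"] by (simp flip: e_def)
    qed
    ultimately have "val_ge (real (Suc t) - real d - real_of_int k) (2 * bil B e (unit_vec n j))"
      using val_ge_divide[OF k val_ge_divide[OF q]] by simp
    then show ?thesis by (rule val_ge_mono) (simp add: rk rd field_simps)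
  qed
  ultimately show ?thesis using that[of i e] i em by (simp add: m_def)
qed

text \<open>Negating the entries of column \<open>i\<close> other than the 1 gives the inverse,
  again integral.\<close>

lemma GL_int_replace_col:
  assumes e: "e \<in> carrier_vec n" "\<And>r. r < n \<Longrightarrow> val_ge 0 (e $ r)" and i: "i < n" "e $ i = 1"
  shows "mat n n (\<lambda>(r, c). if c = i then e $ r else if r = c then 1 else 0) \<in> GL_int ord n"
proof -
  define T where "T f = mat n n (\<lambda>(r, c). if c = i then f r else if r = c then 1 else (0::'a))" for f
  have inv: "T f * T g = 1\<^sub>m n" if "f i = 1" "g i = 1" "\<And>r. r \<noteq> i \<Longrightarrow> g r = - f r" for f g
  proof (rule eq_matI)
    fix r c assume "r < dim_row (1\<^sub>m n)" "c < dim_col (1\<^sub>m n)"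
    then have rc: "r < n" "c < n" by auto
    have "(T f * T g) $$ (r, c) = (\<Sum>k=0..<n. T f $$ (r, k) * T g $$ (k, c))"
      using rc by (simp add: T_def scalar_prod_def)
    also have "\<dots> = T f $$ (r, i) * T g $$ (i, c) + (\<Sum>k\<in>{0..<n} - {i}. T f $$ (r, k) * T g $$ (k, c))"
      using i by (subst sum.remove[of _ i]) auto
    also have "(\<Sum>k\<in>{0..<n} - {i}. T f $$ (r, k) * T g $$ (k, c)) =
        (\<Sum>k\<in>{0..<n} - {i}. if k = r then T g $$ (r, c) else 0)"
      using rc by (intro sum.cong) (auto simp: T_def)
    also have "\<dots> = (if r = i then 0 else T g $$ (r, c))" using rc by auto
    finally show "(T f * T g) $$ (r, c) = 1\<^sub>m n $$ (r, c)"
      using rc i that by (auto simp: T_def)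
  qed (auto simp: T_def)
  define f where "f = (\<lambda>r. e $ r)"
  define g where "g r = (if r = i then 1 else - e $ r)" for r
  have "T f \<in> int_mats ord n" "T g \<in> int_mats ord n"
    using e by (auto intro!: int_matsI val_ge_minus val_ge_one simp: T_def f_def g_def)
  moreover have "T f * T g = 1\<^sub>m n" "T g * T f = 1\<^sub>m n"
    using i by (auto intro!: inv simp: f_def g_def)
  ultimately have "T f \<in> GL_int ord n" by (rule GL_intI)
  then show ?thesis by (simp add: T_def f_def)
qed

lemma GL_int_swaprows_mat: "k < n \<Longrightarrow> l < n \<Longrightarrow> swaprows_mat n k l \<in> GL_int ord n"
  by (rule GL_intI[of _ _ "swaprows_mat n k l"])
    (auto intro!: int_matsI val_ge_one swaprows_mat_inv)

text \<open>A change of basis puts \<open>e\<close> in the last position of exponent m = a_i, where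
  the exponent can then rise to m + 1.\<close>

lemma lex_improvement:
  assumes B: "B \<in> M_set ord n a" and a: "length a = n" "sorted a"
    and i: "i < n" and e: "e \<in> filt n a (real (a ! i))" "e $ i = 1"
    and quad: "val_ge (real (a ! i) + 1) (bil B e e)"
    and cross: "\<And>j. j < n \<Longrightarrow> a ! j \<le> a ! i \<Longrightarrow>
      val_ge ((real (a ! i) + real (a ! j) + 1) / 2) (2 * bil B e (unit_vec n j))"
  obtains V c where "V \<in> GL_int ord n" "c \<in> S_set ord n (mat_act B V)" "(a, c) \<in> lex less_than"
proof -
  define m where "m = a ! i"
  \<comment> \<open>Raising the last entry equal to m keeps the sequence sorted, since all later
    entries are at least m + 1.\<close>
  define l where "l = Max {j. j < n \<and> a ! j = m}"
  have "l \<in> {j. j < n \<and> a ! j = m}"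
    unfolding l_def using i by (intro Max_in) (auto simp: m_def)
  then have l: "l < n" "a ! l = m" by auto
  have le_l: "j \<le> l" if "j < n" "a ! j = m" for j
    unfolding l_def using that by (intro Max_ge) auto
  have il: "i \<le> l" using le_l i by (simp add: m_def)
  have gt_l: "m < a ! j" if "l < j" "j < n" for j
    using le_l[of j] sorted_nth_mono[of a l j] a l that by fastforce
  have le_m: "a ! j \<le> m" if "j < l" for j
    using sorted_nth_mono[of a j l] a l that by simp

  \<comment> \<open>Past \<open>l\<close> the exponents are cut to m + 1: \<open>cross\<close> says
    nothing about pairings of \<open>e\<close> with those basis vectors, and the general bound
    secures only m + 1.\<close>
  define c where "c = take l a @ replicate (n - l) (m + 1)"
  have c_nth: "c ! j = (if j < l then a ! j else m + 1)" if "j < n" for j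
    using that l a by (simp add: c_def nth_append)
  have "length c = n" using a l by (simp add: c_def)
  moreover have "sorted c"
  proof -
    have "x \<le> m + 1" if "x \<in> set (take l a)" for x
      using that le_m a l by (fastforce simp: in_set_conv_nth)
    then show ?thesis using a by (auto simp: c_def sorted_append sorted_wrt_take)
  qed
  moreover have lex: "(a, c) \<in> lex less_than"
  proof -
    have "a = take l a @ m # drop (Suc l) a"
      using id_take_nth_drop[of l a] l a by simp
    moreover have "c = take l a @ (m + 1) # replicate (n - Suc l) (m + 1)"
      using l by (simp add: c_def Suc_diff_Suc flip: replicate_Suc)
    moreover have "length a = length c" using a l by (simp add: c_def)
    moreover have "(m, m + 1) \<in> less_than" by simp
    ultimately show ?thesis unfolding lex_conv by blast
  qed

  define T where "T = mat n n (\<lambda>(r, c). if c = i then e $ r else if r = c then 1 else 0)"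
  \<comment> \<open>\<open>T\<close> replaces basis vector \<open>i\<close> by \<open>e\<close>; the
    swap moves \<open>e\<close> to position \<open>l\<close> and the old vector \<open>l\<close> to
    position \<open>i\<close>, where the exponent is also m.\<close>
  define V where "V = T * swaprows_mat n i l"
  have ec: "e \<in> carrier_vec n" using filtD(1)[OF e(1)] .
  have "T \<in> GL_int ord n"
    unfolding T_def using filtD(2)[OF e(1)] by (intro GL_int_replace_col ec i e) auto
  then have V: "V \<in> GL_int ord n"
    unfolding V_def by (intro GL_int_mult GL_int_swaprows_mat i l)
  have Vc: "V \<in> carrier_mat n n" using GL_int_carrier[OF V] .
  have V_swap: "V = swapcols i l T"
    unfolding V_def using i l by (intro swapcols_mat[symmetric, of _ n]) (auto simp: T_def)
  have col_l: "col V l = e"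
    using i l ec by (intro eq_vecI) (auto simp: V_swap T_def)
  define \<sigma> where "\<sigma> j = (if j = i then l else j)" for j
  have col_j: "col V j = unit_vec n (\<sigma> j)" if "j < n" "j \<noteq> l" for j
    using that i l by (intro eq_vecI) (auto simp: V_swap T_def \<sigma>_def index_unit_vec(1))
  have \<sigma>: "\<sigma> j < n" "c ! j \<le> a ! \<sigma> j" "j < l \<Longrightarrow> a ! \<sigma> j = a ! j" "l < j \<Longrightarrow> \<sigma> j = j"
    if "j < n" "j \<noteq> l" for j
    using that l il gt_l[of j] c_nth[of j] by (auto simp: \<sigma>_def m_def)
  have col_filt: "col V j \<in> filt n a (real (c ! j))" if "j < n" "j \<noteq> l" for j
    using unit_vec_filt[OF \<sigma>(1)[OF that], of a] filt_mono[of "real (c ! j)" "real (a ! \<sigma> j)" n a]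
      \<sigma>(2)[OF that] by (auto simp: col_j[OF that])
  have cl: "c ! l = m + 1" using c_nth l by simp
  have Bc: "B \<in> carrier_mat n n" "transpose_mat B = B" using M_setD(1,2)[OF B] .

  have "mat_act B V \<in> M_set ord n c"
  proof (rule M_setI)
    fix j assume j: "j < n"
    show "val_ge (real (c ! j)) (mat_act B V $$ (j, j))"
    proof (cases "j = l")
      case True
      then show ?thesis using quad
        by (simp add: mat_act_index[OF Bc(1) Vc] j cl col_l l m_def add.commute)
    next
      case False
      then show ?thesis using val_ge_quad[OF B col_filt[OF j]]
        by (simp add: mat_act_index[OF Bc(1) Vc] j)
    qed
  next
    fix j k assume jk: "j < k" "k < n"
    then have j: "j < n" by simp
    have idx: "mat_act B V $$ (j, k) = bil B (col V j) (col V k)"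
      by (rule mat_act_index[OF Bc(1) Vc j jk(2)])
    consider "j = l" | "k = l" | "j \<noteq> l" "k \<noteq> l" by blast
    then show "val_ge ((real (c ! j) + real (c ! k)) / 2) (2 * mat_act B V $$ (j, k))"
    proof cases
      case 1
      then have k: "l < k" "k \<noteq> l" using jk by auto
      \<comment> \<open>Here a_k >= m + 1, so the bound is at least m + 1/2 and rounds up to m +
        1.\<close>
      have "val_ge ((real m + real (a ! k)) / 2) (2 * bil B e (unit_vec n k))"
        using val_ge_bil[OF B e(1) unit_vec_filt[OF jk(2)]] by (simp add: m_def)
      moreover have "real m + 1 \<le> real (a ! k)" using gt_l[OF k(1) jk(2)] by simp
      ultimately have "val_ge (real (m + 1)) (2 * bil B e (unit_vec n k))"
        by (intro val_ge_integral_nat) auto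
      moreover have "(real (c ! j) + real (c ! k)) / 2 = real (m + 1)"
        using 1 k cl c_nth[OF jk(2)] by simp
      moreover have "bil B (col V j) (col V k) = bil B e (unit_vec n k)"
        using 1 col_l col_j[OF jk(2) k(2)] \<sigma>(4)[OF jk(2) k(2) k(1)] by simp
      ultimately show ?thesis unfolding idx by (simp only:)
    next
      case 2
      then have jl: "j < l" "j \<noteq> l" using jk by auto
      have "val_ge ((real m + real (a ! \<sigma> j) + 1) / 2) (2 * bil B e (unit_vec n (\<sigma> j)))"
        using cross[OF \<sigma>(1)[OF j jl(2)]] \<sigma>(3)[OF j jl(2) jl(1)] le_m[OF jl(1)] by (simp add: m_def)
      moreover have "bil B (col V j) (col V k) = bil B e (unit_vec n (\<sigma> j))"
        using 2 col_l col_j[OF j jl(2)] bil_commute[OF Bc(1) _ ec Bc(2)] by simp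
      moreover have "real (c ! j) + real (c ! k) = real m + real (a ! \<sigma> j) + 1"
        using 2 cl c_nth[OF j] jl \<sigma>(3)[OF j jl(2) jl(1)] by simp
      ultimately show ?thesis unfolding idx by simp
    next
      case 3
      then show ?thesis unfolding idx using val_ge_bil[OF B col_filt[OF j] col_filt[OF jk(2)]] by simp
    qed
  qed (use Bc Vc in \<open>simp_all add: mat_act_carrier mat_act_symmetric\<close>)
  ultimately have "c \<in> S_set ord n (mat_act B V)" by (simp add: S_set_def)
  then show ?thesis using that V lex by blast
qed

text \<open>One inclusion is rounding of t + 1/2; for the other, a vector outside L_{t+1} would
  yield a lexicographically larger sequence.\<close>

lemma filt_Suc:
  assumes B: "B \<in> M_set ord n a" and a: "length a = n" "sorted a"
    and maximal: "\<And>V c. V \<in> GL_int ord n \<Longrightarrow> c \<in> S_set ord n (mat_act B V) \<Longrightarrow> (a, c) \<notin> lex less_than"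
  shows "filt n a (real (Suc t)) = {x \<in> filt n a (real t). val_ge (real (Suc t)) (bil B x x) \<and>
      (\<forall>y\<in>filt n a (real t). val_ge (real (Suc t)) (2 * bil B x y))}"
proof (intro equalityI subsetI)
  fix x assume x: "x \<in> filt n a (real (Suc t))"
  have "val_ge (real (Suc t)) (2 * bil B x y)" if "y \<in> filt n a (real t)" for y
    by (rule val_ge_integral_nat[OF val_ge_bil[OF B x that]]) simp
  moreover have "x \<in> filt n a (real t)" using x filt_mono[of "real t" "real (Suc t)" n a] by auto
  ultimately show "x \<in> {x \<in> filt n a (real t). val_ge (real (Suc t)) (bil B x x) \<and>
      (\<forall>y\<in>filt n a (real t). val_ge (real (Suc t)) (2 * bil B x y))}"
    using val_ge_quad[OF B x] by blast
next
  fix x assume "x \<in> {x \<in> filt n a (real t). val_ge (real (Suc t)) (bil B x x) \<and>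
      (\<forall>y\<in>filt n a (real t). val_ge (real (Suc t)) (2 * bil B x y))}"
  then have x: "x \<in> filt n a (real t)" "val_ge (real (Suc t)) (bil B x x)"
    "\<And>y. y \<in> filt n a (real t) \<Longrightarrow> val_ge (real (Suc t)) (2 * bil B x y)" by auto
  show "x \<in> filt n a (real (Suc t))"
  proof (rule ccontr)
    assume "x \<notin> filt n a (real (Suc t))"
    then obtain i e where ie: "i < n" "e \<in> filt n a (real (a ! i))" "e $ i = 1"
      "val_ge (real (a ! i) + 1) (bil B e e)"
      "\<And>j. j < n \<Longrightarrow> a ! j \<le> a ! i \<Longrightarrow>
        val_ge ((real (a ! i) + real (a ! j) + 1) / 2) (2 * bil B e (unit_vec n j))"
      using obtain_reducible_vector[OF B a x(1) _ x(2,3)] by blast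
    show False using lex_improvement[OF B a ie] maximal by blast
  qed
qed


section \<open>Existence of the Gross-Keating invariant\<close>

text \<open>\<open>lex\<close> compares only lists of equal length; on those it is a strict total
  order, so the maximum exists and is unique.\<close>

lemma lex_greatest_works:
  assumes "finite A" "A \<noteq> {}" "\<And>x. x \<in> A \<Longrightarrow> length x = n"
  shows "lex_greatest A \<in> A \<and> (\<forall>b\<in>A. b = lex_greatest A \<or> (b, lex_greatest A) \<in> lex less_than)"
proof -
  have trans: "(x, z) \<in> lex less_than" if "(x, y) \<in> lex less_than" "(y, z) \<in> lex less_than"
    for x y z :: "nat list"
    using that lex_transI[OF trans_less_than] by (meson transD)
  have irrefl: "(x, x) \<notin> lex less_than" for x :: "nat list"
    by (rule lexl_not_refl) (simp add: irrefl_def)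
  have total: "(x, y) \<in> lex less_than \<or> x = y \<or> (y, x) \<in> lex less_than"
    if "length x = length y" for x y :: "nat list"
    using lexord_linear[of less_than x y] that by (simp add: lexord_lex) (metis linorder_neqE_nat)
  have "\<exists>a. a \<in> A \<and> (\<forall>b\<in>A. b = a \<or> (b, a) \<in> lex less_than)"
    using assms
  proof (induction A rule: finite_ne_induct)
    case (insert x F)
    then obtain a where a: "a \<in> F" "\<forall>b\<in>F. b = a \<or> (b, a) \<in> lex less_than" by auto
    have "length x = length a" using insert.prems a(1) by simp
    then consider "(x, a) \<in> lex less_than" | "x = a" | "(a, x) \<in> lex less_than" using total by blast
    then show ?case
    proof cases
      case 1
      then show ?thesis using a by (intro exI[of _ a]) simp
    next
      case 2
      then show ?thesis using a by (intro exI[of _ a]) simp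
    next
      case 3
      have "b = x \<or> (b, x) \<in> lex less_than" if "b \<in> insert x F" for b
        using that a(2) trans[OF _ 3] 3 by (metis insertE)
      then show ?thesis by (intro exI[of _ x]) simp
    qed
  qed simp
  then obtain a where a: "a \<in> A" "\<And>b. b \<in> A \<Longrightarrow> b = a \<or> (b, a) \<in> lex less_than" by auto
  have "\<exists>!a. a \<in> A \<and> (\<forall>b\<in>A. b = a \<or> (b, a) \<in> lex less_than)"
  proof (rule ex1I[of _ a])
    fix y assume y: "y \<in> A \<and> (\<forall>b\<in>A. b = y \<or> (b, y) \<in> lex less_than)"
    show "y = a"
    proof (rule ccontr)
      assume "y \<noteq> a"
      then have "(y, a) \<in> lex less_than" "(a, y) \<in> lex less_than" using y a by auto
      then show False using trans irrefl by metis
    qed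
  qed (use a in simp)
  from theI'[OF this] show ?thesis unfolding lex_greatest_def .
qed

text \<open>The sum of the exponents is at most the valuation of det(2B), which is finite because
  det B is nonzero.\<close>

lemma finite_orbit_sequences:
  assumes "B \<in> half_integral_nd ord n"
  shows "finite (\<Union>V \<in> GL_int ord n. S_set ord n (mat_act B V))"
proof -
  have B: "B \<in> carrier_mat n n" "det B \<noteq> 0"
    using assms by (auto simp: half_integral_nd_def half_integral_def)
  have "2 ^ n * det B \<noteq> 0" using B(2) by simp
  then obtain k where k: "\<And>r. val_ge r (2 ^ n * det B) \<longleftrightarrow> r \<le> real_of_int k"
    using ord_nonzero by blast
  have "set c \<subseteq> {..nat k} \<and> length c = n"
    if V: "V \<in> GL_int ord n" and c: "c \<in> S_set ord n (mat_act B V)" for V c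
  proof -
    obtain V' where V': "V' \<in> int_mats ord n" "V * V' = 1\<^sub>m n" "V \<in> carrier_mat n n" "V' \<in> carrier_mat n n"
      using GL_intE[OF V] by blast
    define D where "D = 2 \<cdot>\<^sub>m mat_act B V"
    have M: "mat_act B V \<in> M_set ord n c" and len: "length c = n" using c by (auto simp: S_set_def)
    have D: "D \<in> carrier_mat n n" using M_setD(1)[OF M] by (simp add: D_def)
    have "val_ge (\<Sum>i<n. real (c ! i)) (det D)"
      using M_setD(1,4)[OF M] by (intro val_ge_det[OF D]) (simp add: D_def)
    \<comment> \<open>Multiplying det(2B[V]) by det(V')^2 recovers det(2B), so integrality of det V'
      makes the bound uniform in \<open>V\<close>.\<close>
    moreover have "val_ge 0 (det V')"
      using val_ge_det[OF V'(4), of "\<lambda>_. 0"] int_matsD(2)[OF V'(1)] by simp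
    ultimately have "val_ge ((\<Sum>i<n. real (c ! i)) + 0 + 0) (det D * det V' * det V')"
      by (intro val_ge_mult)
    moreover have "det D * det V' * det V' = 2 ^ n * det B"
    proof -
      have "det V * det V' = 1" using det_mult[OF V'(3,4)] V'(2) by simp
      moreover have "det (mat_act B V) = det V * det B * det V"
        using B V' by (simp add: mat_act_def det_mult[of _ n] det_transpose[of _ n])
      moreover have "det D = 2 ^ n * det (mat_act B V)"
        using mat_act_carrier[OF B(1) V'(3)] by (simp add: D_def)
      ultimately have "det D * det V' * det V' = 2 ^ n * (det V * det B * det V) * det V' * det V'"
        by (simp only:)
      also have "\<dots> = 2 ^ n * det B * (det V * det V') * (det V * det V')"
        by (simp only: mult.assoc mult.commute mult.left_commute)
      also have "\<dots> = 2 ^ n * det B" using \<open>det V * det V' = 1\<close> by (simp only: mult_1_right)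
      finally show ?thesis .
    qed
    ultimately have sum_le: "(\<Sum>i<n. real (c ! i)) \<le> real_of_int k" by (simp add: k)
    have "c ! i \<le> nat k" if "i < n" for i
    proof -
      have "real (c ! i) \<le> (\<Sum>i<n. real (c ! i))" using that by (intro member_le_sum) auto
      then show ?thesis using sum_le by linarith
    qed
    then show ?thesis using len by (auto simp: in_set_conv_nth)
  qed
  then have "(\<Union>V \<in> GL_int ord n. S_set ord n (mat_act B V)) \<subseteq> {c. set c \<subseteq> {..nat k} \<and> length c = n}"
    by blast
  then show ?thesis by (rule finite_subset) (simp add: finite_lists_length_eq)
qed

lemma GK_upper_bound:
  assumes B: "B \<in> half_integral_nd ord n" and "V \<in> GL_int ord n" "c \<in> S_set ord n (mat_act B V)"
  shows "(GK ord n B, c) \<notin> lex less_than"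
proof -
  let ?A = "\<Union>V \<in> GL_int ord n. S_set ord n (mat_act B V)"
  have "c \<in> ?A" using assms by blast
  moreover have "length x = n" if "x \<in> ?A" for x using that by (auto simp: S_set_def)
  ultimately have "c = GK ord n B \<or> (c, GK ord n B) \<in> lex less_than"
    using lex_greatest_works[OF finite_orbit_sequences[OF B]] unfolding GK_def by blast
  moreover have "asym (lex less_than)" by (rule asym_lex) (simp add: asym_on_def)
  ultimately show ?thesis by (auto dest: asymD)
qed

end

section \<open>Optimality of B[U] and the group G_a\<close>

theorem theorem0p2:
  fixes ord :: "'a::field_char_0 \<Rightarrow> ereal"
    and n :: nat and B U :: "'a mat" and a :: "nat list"
  assumes "nonarch_local_field ord"
    and "B \<in> half_integral_nd ord n"
    and "optimal ord n B"
    and "GK ord n B = a"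
    and "U \<in> GL_int ord n"
  shows "optimal ord n (mat_act B U) \<longleftrightarrow> U \<in> G_group ord n a"
proof -
  interpret nonarch_local_field ord by fact
  have Bc: "B \<in> carrier_mat n n"
    using assms(2) by (auto simp: half_integral_nd_def half_integral_def)
  have U: "U \<in> carrier_mat n n" using GL_int_carrier[OF assms(5)] .
  have GK_U: "GK ord n (mat_act B U) = a"
    using assms(4) unfolding GK_def GL_int_orbit[OF Bc assms(5)] .
  have a: "length a = n" "sorted a" and B: "B \<in> M_set ord n a"
    using assms(3,4) by (auto simp: optimal_def S_set_def)
  have optimal_U: "optimal ord n (mat_act B U) \<longleftrightarrow> mat_act B U \<in> M_set ord n a"
    using a by (simp add: optimal_def GK_U S_set_def)
  show ?thesis
  proof
    assume "optimal ord n (mat_act B U)"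
    then have BU: "mat_act B U \<in> M_set ord n a" by (simp add: optimal_U)
    have maximal: "(a, c) \<notin> lex less_than"
      if "V \<in> GL_int ord n" "c \<in> S_set ord n (mat_act B V)" for V c
      using GK_upper_bound[OF assms(2) that] assms(4) by simp
    \<comment> \<open>B[U][V] = B[UV], so B[U] inherits maximality from \<open>B\<close> and the
      filtration steps have the same description for both forms.\<close>
    have maximal_U: "(a, c) \<notin> lex less_than"
      if "V \<in> GL_int ord n" "c \<in> S_set ord n (mat_act (mat_act B U) V)" for V c
      using maximal[OF GL_int_mult[OF assms(5) that(1)]] that
      by (simp add: mat_act_mult[OF Bc U GL_int_carrier])
    have "(\<lambda>x. U *\<^sub>v x) ` filt n a (real t) = filt n a (real t)" for t
      by (rule filt_transport[OF Bc assms(5) filt_Suc[OF B a maximal] filt_Suc[OF BU a maximal_U]])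
    \<comment> \<open>The \<open>j\<close>-th unit vector lies in L_t for t = a_j, hence so does its
      image, the \<open>j\<close>-th column.\<close>
    then have "col U j \<in> filt n a (real (a ! j))" if "j < n" for j
      using unit_vec_filt[OF that, of a] mult_unit_vec[OF U that] by (metis imageI)
    then show "U \<in> G_group ord n a" using G_group_iff_filt[OF assms(5)] by blast
  next
    assume "U \<in> G_group ord n a"
    then show "optimal ord n (mat_act B U)"
      unfolding optimal_U using G_group_iff_filt[OF assms(5)] by (intro M_set_mat_act[OF B U]) blast
  qed
qed

end
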